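(* For every finite multiset $G$ of I/O pairs and every pair $(B,Y)$: the I/O sequent $G\vdash(B,Y)$ is derivable in the calculus $\mathbf{C}_2$ if and only if $G\vdash_{OUT_2^+}(B,Y)$, i.e. $(B,Y)$ is derivable from the pairs in $G$ in the logic $OUT_2^+$.
   Context: Formulas are classical propositional formulas built with $\top,\bot,\neg,\wedge,\vee,\to$; $\models$ denotes classical semantic entailment. An I/O pair is an ordered pair $(A,X)$ of formulas. Rules on pairs: (TOP) $(\top,\top)$ is derivable from no premises; (BOT) $(\bot,\bot)$ is derivable from no premises; (WO) from $(A,X)$ derive $(A,Y)$ whenever $X\models Y$; (SI) from $(A,X)$ derive $(B,X)$ whenever $B\models A$; (AND) from $(A,X_1)$ and $(A,X_2)$ derive $(A,X_1\wedge X_2)$; (OR) from $(A_1,X)$ and $(A_2,X)$ derive $(A_1\vee A_2,X)$. The logic $OUT_2^+$ consists of the rules TOP, BOT, WO, SI, AND, OR. $G\vdash_{OUT_2^+}(B,Y)$ means there is a finite tree with root $(B,Y)$, each leaf an element of $G$ or an axiom (TOP or BOT), and each non-leaf node obtained from its children by one of these rules. An LK sequent $\Gamma\Rightarrow\Delta$ ($\Gamma,\Delta$ finite multisets of formulas) is derivable in Gentzen's LK iff $\bigwedge\Gamma\models\bigvee\Delta$ (empty conjunction $=\top$, empty disjunction $=\bot$). An I/O sequent has the form $G\vdash(B,Y)$ with $G$ a finite multiset of pairs. The calculus $\mathbf{C}_2$ has the rules: (IN) from the LK sequent $B\Rightarrow$ infer $G\vdash(B,Y)$; (OUT) from the LK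 sequent $\Rightarrow Y$ infer $G\vdash(B,Y)$; (E2) from $G\vdash(B\wedge\neg A,Y)$ and $G\vdash(B,Y\vee\neg X)$ infer $(A,X),G\vdash(B,Y)$. An I/O sequent is derivable in $\mathbf{C}_2$ if it is the root of a finite tree built with these rules in which every LK-sequent premise is derivable in LK. *)

theory Defs
  imports "HOL-Library.Multiset"
begin

datatype 'a formula =
    Atom 'a
  | Top
  | Bot
  | Neg "'a formula"
  | Conj "'a formula" "'a formula"
  | Disj "'a formula" "'a formula"
  | Imp "'a formula" "'a formula"

primrec sat :: "('a \<Rightarrow> bool) \<Rightarrow> 'a formula \<Rightarrow> bool" where
  "sat v (Atom a) = v a"
| "sat v Top = True"
| "sat v Bot = False"
| "sat v (Neg A) = (\<not> sat v A)"
| "sat v (Conj A B) = (sat v A \<and> sat v B)"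
| "sat v (Disj A B) = (sat v A \<or> sat v B)"
| "sat v (Imp A B) = (sat v A \<longrightarrow> sat v B)"

definition entails :: "'a formula \<Rightarrow> 'a formula \<Rightarrow> bool" where
  "entails A B \<longleftrightarrow> (\<forall>v. sat v A \<longrightarrow> sat v B)"

type_synonym 'a io_pair = "'a formula \<times> 'a formula"

text \<open>In the rule systems below, a finite derivation tree is rendered as membership in
  the least relation closed under the rules.\<close>

inductive OUT2_plus :: "'a io_pair multiset \<Rightarrow> 'a io_pair \<Rightarrow> bool" for G where
  Leaf: "p \<in># G \<Longrightarrow> OUT2_plus G p"
| TOP: "OUT2_plus G (Top, Top)"
| BOT: "OUT2_plus G (Bot, Bot)"
| WO: "OUT2_plus G (A, X) \<Longrightarrow> entails X Y \<Longrightarrow> OUT2_plus G (A, Y)"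
| SI: "OUT2_plus G (A, X) \<Longrightarrow> entails B A \<Longrightarrow> OUT2_plus G (B, X)"
| AND: "OUT2_plus G (A, X1) \<Longrightarrow> OUT2_plus G (A, X2) \<Longrightarrow> OUT2_plus G (A, Conj X1 X2)"
| OR: "OUT2_plus G (A1, X) \<Longrightarrow> OUT2_plus G (A2, X) \<Longrightarrow> OUT2_plus G (Disj A1 A2, X)"

text \<open>Gentzen's propositional LK with cut. Sequents are pairs of multisets, so there is no
  exchange rule, and \<open>\<top>\<close>, \<open>\<bottom>\<close> come with axioms of their own.\<close>

inductive LK :: "'a formula multiset \<Rightarrow> 'a formula multiset \<Rightarrow> bool" where
  Ax: "LK {#A#} {#A#}"
| TopR: "LK {#} {#Top#}"
| BotL: "LK {#Bot#} {#}"
| Cut: "LK \<Gamma> (add_mset A \<Delta>) \<Longrightarrow> LK (add_mset A \<Sigma>) \<Pi> \<Longrightarrow> LK (\<Gamma> + \<Sigma>) (\<Delta> + \<Pi>)"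
| WeakL: "LK \<Gamma> \<Delta> \<Longrightarrow> LK (add_mset A \<Gamma>) \<Delta>"
| WeakR: "LK \<Gamma> \<Delta> \<Longrightarrow> LK \<Gamma> (add_mset A \<Delta>)"
| ContrL: "LK (add_mset A (add_mset A \<Gamma>)) \<Delta> \<Longrightarrow> LK (add_mset A \<Gamma>) \<Delta>"
| ContrR: "LK \<Gamma> (add_mset A (add_mset A \<Delta>)) \<Longrightarrow> LK \<Gamma> (add_mset A \<Delta>)"
| NegL: "LK \<Gamma> (add_mset A \<Delta>) \<Longrightarrow> LK (add_mset (Neg A) \<Gamma>) \<Delta>"
| NegR: "LK (add_mset A \<Gamma>) \<Delta> \<Longrightarrow> LK \<Gamma> (add_mset (Neg A) \<Delta>)"
| ConjL1: "LK (add_mset A \<Gamma>) \<Delta> \<Longrightarrow> LK (add_mset (Conj A B) \<Gamma>) \<Delta>"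
| ConjL2: "LK (add_mset B \<Gamma>) \<Delta> \<Longrightarrow> LK (add_mset (Conj A B) \<Gamma>) \<Delta>"
| ConjR: "LK \<Gamma> (add_mset A \<Delta>) \<Longrightarrow> LK \<Gamma> (add_mset B \<Delta>)
    \<Longrightarrow> LK \<Gamma> (add_mset (Conj A B) \<Delta>)"
| DisjL: "LK (add_mset A \<Gamma>) \<Delta> \<Longrightarrow> LK (add_mset B \<Gamma>) \<Delta>
    \<Longrightarrow> LK (add_mset (Disj A B) \<Gamma>) \<Delta>"
| DisjR1: "LK \<Gamma> (add_mset A \<Delta>) \<Longrightarrow> LK \<Gamma> (add_mset (Disj A B) \<Delta>)"
| DisjR2: "LK \<Gamma> (add_mset B \<Delta>) \<Longrightarrow> LK \<Gamma> (add_mset (Disj A B) \<Delta>)"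
| ImpL: "LK \<Gamma> (add_mset A \<Delta>) \<Longrightarrow> LK (add_mset B \<Sigma>) \<Pi>
    \<Longrightarrow> LK (add_mset (Imp A B) (\<Gamma> + \<Sigma>)) (\<Delta> + \<Pi>)"
| ImpR: "LK (add_mset A \<Gamma>) (add_mset B \<Delta>) \<Longrightarrow> LK \<Gamma> (add_mset (Imp A B) \<Delta>)"

inductive C2 :: "'a io_pair multiset \<Rightarrow> 'a io_pair \<Rightarrow> bool" where
  IN: "LK {#B#} {#} \<Longrightarrow> C2 G (B, Y)"
| OUT: "LK {#} {#Y#} \<Longrightarrow> C2 G (B, Y)"
| E2: "C2 G (Conj B (Neg A), Y) \<Longrightarrow> C2 G (B, Disj Y (Neg X))
    \<Longrightarrow> C2 (add_mset (A, X) G) (B, Y)"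

text \<open>Adequacy of \<^const>\<open>LK\<close>: derivability coincides with the classical entailment
  \<open>\<And>\<Gamma> \<Turnstile> \<Or>\<Delta>\<close>, the empty conjunction being true and the empty disjunction false.\<close>

definition valid_sequent :: "'a formula multiset \<Rightarrow> 'a formula multiset \<Rightarrow> bool" where
  "valid_sequent \<Gamma> \<Delta> \<longleftrightarrow> (\<forall>v. (\<forall>A\<in>#\<Gamma>. sat v A) \<longrightarrow> (\<exists>B\<in>#\<Delta>. sat v B))"

lemma LK_sound: "LK \<Gamma> \<Delta> \<Longrightarrow> valid_sequent \<Gamma> \<Delta>"
  by (induction rule: LK.induct) (simp_all add: valid_sequent_def, blast+)

lemma LK_weaken: "LK \<Gamma> \<Delta> \<Longrightarrow> LK (\<Sigma> + \<Gamma>) (\<Pi> + \<Delta>)"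
proof -
  assume "LK \<Gamma> \<Delta>"
  hence "LK (\<Sigma> + \<Gamma>) \<Delta>" by (induction \<Sigma>) (auto intro: LK.WeakL)
  thus ?thesis by (induction \<Pi>) (auto intro: LK.WeakR)
qed

lemma LK_axiom:
  assumes "A \<in># \<Gamma>" "A \<in># \<Delta>" shows "LK \<Gamma> \<Delta>"
  using LK_weaken[OF LK.Ax[of A], of "\<Gamma> - {#A#}" "\<Delta> - {#A#}"] assms by simp

lemma LK_contr_all: "LK (\<Sigma> + \<Gamma> + \<Gamma>) (\<Pi> + \<Delta> + \<Delta>) \<Longrightarrow> LK (\<Sigma> + \<Gamma>) (\<Pi> + \<Delta>)"
proof (induction \<Gamma> arbitrary: \<Sigma>)
  case empty
  thus ?case
  proof (induction \<Delta> arbitrary: \<Pi>)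
    case (add A \<Delta>)
    have "LK \<Sigma> (add_mset A (\<Pi> + \<Delta>) + \<Delta>)"
      using LK.ContrR[of \<Sigma> A "\<Pi> + \<Delta> + \<Delta>"] add.prems by simp
    thus ?case using add.IH[of "add_mset A \<Pi>"] by simp
  qed simp
next
  case (add A \<Gamma>)
  have "LK (add_mset A \<Sigma> + \<Gamma> + \<Gamma>) (\<Pi> + \<Delta> + \<Delta>)"
    using LK.ContrL[of A "\<Sigma> + \<Gamma> + \<Gamma>" "\<Pi> + \<Delta> + \<Delta>"] add.prems by simp
  thus ?case using add.IH[of "add_mset A \<Sigma>"] by simp
qed

lemma LK_ConjL: "LK (add_mset A (add_mset B \<Gamma>)) \<Delta> \<Longrightarrow> LK (add_mset (Conj A B) \<Gamma>) \<Delta>"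
  by (metis LK.ConjL1 LK.ConjL2 LK.ContrL add_mset_commute)

lemma LK_DisjR: "LK \<Gamma> (add_mset A (add_mset B \<Delta>)) \<Longrightarrow> LK \<Gamma> (add_mset (Disj A B) \<Delta>)"
  by (metis LK.DisjR1 LK.DisjR2 LK.ContrR add_mset_commute)

lemma LK_ImpL:
  "LK \<Gamma> (add_mset A \<Delta>) \<Longrightarrow> LK (add_mset B \<Gamma>) \<Delta> \<Longrightarrow> LK (add_mset (Imp A B) \<Gamma>) \<Delta>"
  using LK.ImpL[of \<Gamma> A \<Delta> B \<Gamma> \<Delta>] LK_contr_all[of "{#Imp A B#}" \<Gamma> "{#}" \<Delta>] by simp

lemma LK_complete: "valid_sequent \<Gamma> \<Delta> \<Longrightarrow> LK \<Gamma> \<Delta>"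
proof (induction "sum_mset (image_mset size \<Gamma>) + sum_mset (image_mset size \<Delta>)"
    arbitrary: \<Gamma> \<Delta> rule: less_induct)
  case less
  note IH = less.hyps and valid = less.prems[unfolded valid_sequent_def]
  let ?basic = "\<lambda>A. (\<exists>a. A = Atom a) \<or> A = Top \<or> A = Bot"
  consider (L) A where "A \<in># \<Gamma>" "\<not> ?basic A" | (R) A where "A \<in># \<Delta>" "\<not> ?basic A"
    | (B) "\<forall>A\<in>#\<Gamma>. ?basic A" "\<forall>A\<in>#\<Delta>. ?basic A" by blast
  thus ?case
  proof cases
    case L
    then obtain \<Gamma>' where \<Gamma>: "\<Gamma> = add_mset A \<Gamma>'" by (metis multi_member_split)
    show ?thesis
    proof (cases A)
      case (Neg C)
      have "LK \<Gamma>' (add_mset C \<Delta>)"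
        using valid by (intro IH) (auto simp: valid_sequent_def \<Gamma> Neg)
      thus ?thesis unfolding \<Gamma> Neg by (rule LK.NegL)
    next
      case (Conj C D)
      have "LK (add_mset C (add_mset D \<Gamma>')) \<Delta>"
        using valid by (intro IH) (auto simp: valid_sequent_def \<Gamma> Conj)
      thus ?thesis unfolding \<Gamma> Conj by (rule LK_ConjL)
    next
      case (Disj C D)
      have "LK (add_mset C \<Gamma>') \<Delta>" "LK (add_mset D \<Gamma>') \<Delta>"
        using valid by (auto intro!: IH simp: valid_sequent_def \<Gamma> Disj)
      thus ?thesis unfolding \<Gamma> Disj by (rule LK.DisjL)
    next
      case (Imp C D)
      have "LK \<Gamma>' (add_mset C \<Delta>)" "LK (add_mset D \<Gamma>') \<Delta>"
        using valid by (auto intro!: IH simp: valid_sequent_def \<Gamma> Imp)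
      thus ?thesis unfolding \<Gamma> Imp by (rule LK_ImpL)
    qed (use L in auto)
  next
    case R
    then obtain \<Delta>' where \<Delta>: "\<Delta> = add_mset A \<Delta>'" by (metis multi_member_split)
    show ?thesis
    proof (cases A)
      case (Neg C)
      have "LK (add_mset C \<Gamma>) \<Delta>'"
        using valid by (intro IH) (auto simp: valid_sequent_def \<Delta> Neg)
      thus ?thesis unfolding \<Delta> Neg by (rule LK.NegR)
    next
      case (Conj C D)
      have "LK \<Gamma> (add_mset C \<Delta>')" "LK \<Gamma> (add_mset D \<Delta>')"
        using valid by (auto intro!: IH simp: valid_sequent_def \<Delta> Conj) blast+
      thus ?thesis unfolding \<Delta> Conj by (rule LK.ConjR)
    next
      case (Disj C D)
      have "LK \<Gamma> (add_mset C (add_mset D \<Delta>'))"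
        using valid by (intro IH) (auto simp: valid_sequent_def \<Delta> Disj)
      thus ?thesis unfolding \<Delta> Disj by (rule LK_DisjR)
    next
      case (Imp C D)
      have "LK (add_mset C \<Gamma>) (add_mset D \<Delta>')"
        using valid by (intro IH) (auto simp: valid_sequent_def \<Delta> Imp)
      thus ?thesis unfolding \<Delta> Imp by (rule LK.ImpR)
    qed (use R in auto)
  next
    case B
    define v where "v = (\<lambda>a. Atom a \<in># \<Gamma>)"
    consider "Bot \<in># \<Gamma>" | "Top \<in># \<Delta>" | C where "C \<in># \<Delta>" "C \<in># \<Gamma>"
    proof (cases "\<forall>A\<in>#\<Gamma>. sat v A")
      case True
      then obtain C where "C \<in># \<Delta>" "sat v C" using valid by blast
      thus ?thesis using B that by (auto simp: v_def)
    next
      case False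
      then obtain A where "A \<in># \<Gamma>" "\<not> sat v A" by blast
      thus ?thesis using B that by (auto simp: v_def)
    qed
    thus ?thesis
    proof cases
      case 1
      thus ?thesis using LK_weaken[OF LK.BotL, of "\<Gamma> - {#Bot#}" \<Delta>] by simp
    next
      case 2
      thus ?thesis using LK_weaken[OF LK.TopR, of \<Gamma> "\<Delta> - {#Top#}"] by simp
    qed (rule LK_axiom)
  qed
qed

theorem LK_iff_valid: "LK \<Gamma> \<Delta> \<longleftrightarrow> valid_sequent \<Gamma> \<Delta>"
  using LK_sound LK_complete by blast

end

(* Both systems are sound and complete for one two-valuation semantics: every valuation v of B and
   every countervaluation w of Y are separated by some pair (A, X) of G, with v satisfying A and
   w falsifying X. This condition for (A, X), G is the conjunction of the conditions for the two
   premises of E2, so C2 is complete by induction on G. The circle closes because OUT2+ simulates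
   the rules of C2, E2 by a case distinction on A in the input, and is itself sound. *)
theory Submission
  imports Defs
begin

definition separates :: "'a io_pair multiset \<Rightarrow> 'a io_pair \<Rightarrow> bool" where
  "separates G p \<longleftrightarrow> (\<forall>v w. sat v (fst p) \<longrightarrow> \<not> sat w (snd p) \<longrightarrow>
    (\<exists>q\<in>#G. sat v (fst q) \<and> \<not> sat w (snd q)))"

text \<open>\<open>OR\<close> holds as v satisfies one of the disjuncts, \<open>AND\<close> as w
  falsifies one of the conjuncts.\<close>

lemma OUT2_plus_imp_separates: "OUT2_plus G p \<Longrightarrow> separates G p"
proof (induction rule: OUT2_plus.induct)
  case (Leaf p)
  thus ?case by (auto simp: separates_def)
qed (simp_all add: separates_def entails_def, blast+)

lemma separates_imp_C2: "separates G (B, Y) \<Longrightarrow> C2 G (B, Y)"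
proof (induction G arbitrary: B Y)
  case empty
  \<comment> \<open>No pair separates, and v and w vary independently: \<open>B\<close> has no model
    or \<open>Y\<close> no countermodel.\<close>
  hence "valid_sequent {#B#} {#} \<or> valid_sequent {#} {#Y#}"
    by (auto simp: separates_def valid_sequent_def)
  thus ?case by (auto simp: LK_iff_valid intro: C2.IN C2.OUT)
next
  case (add p G)
  obtain A X where p: "p = (A, X)" by fastforce
  \<comment> \<open>Here v falsifies \<open>A\<close>, respectively w satisfies \<open>X\<close>, so
    the separating pair is not \<open>p\<close> and lies in \<open>G\<close>.\<close>
  have "separates G (Conj B (Neg A), Y)" "separates G (B, Disj Y (Neg X))"
    using add.prems by (fastforce simp: separates_def p)+
  thus ?case unfolding p by (intro C2.E2 add.IH)
qed

lemma OUT2_plus_mono: "OUT2_plus G p \<Longrightarrow> G \<subseteq># H \<Longrightarrow> OUT2_plus H p"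
  by (induction rule: OUT2_plus.induct) (auto intro: OUT2_plus.intros mset_subset_eqD)

text \<open>On input \<open>Conj B A\<close>, the outputs \<open>X\<close> and
  \<open>Disj Y (Neg X)\<close> together entail \<open>Y\<close>; \<open>OR\<close> adds the case
  \<open>Neg A\<close>.\<close>

lemma OUT2_plus_E2:
  assumes "OUT2_plus G (A, X)" "OUT2_plus G (Conj B (Neg A), Y)"
    and "OUT2_plus G (B, Disj Y (Neg X))"
  shows "OUT2_plus G (B, Y)"
proof -
  have "OUT2_plus G (Conj B A, X)" "OUT2_plus G (Conj B A, Disj Y (Neg X))"
    using assms by (auto intro: OUT2_plus.SI simp: entails_def)
  hence "OUT2_plus G (Conj B A, Conj X (Disj Y (Neg X)))"
    by (rule OUT2_plus.AND)
  hence "OUT2_plus G (Conj B A, Y)"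
    by (rule OUT2_plus.WO) (auto simp: entails_def)
  hence "OUT2_plus G (Disj (Conj B A) (Conj B (Neg A)), Y)"
    using assms(2) by (rule OUT2_plus.OR)
  thus ?thesis by (rule OUT2_plus.SI) (auto simp: entails_def)
qed

lemma C2_imp_OUT2_plus: "C2 G p \<Longrightarrow> OUT2_plus G p"
proof (induction rule: C2.induct)
  case (IN B G Y)
  hence "entails B Bot"
    by (simp add: LK_iff_valid valid_sequent_def entails_def)
  with OUT2_plus.BOT have "OUT2_plus G (B, Bot)" by (rule OUT2_plus.SI)
  thus ?case by (rule OUT2_plus.WO) (simp add: entails_def)
next
  case (OUT Y G B)
  hence "entails Top Y"
    by (simp add: LK_iff_valid valid_sequent_def entails_def)
  with OUT2_plus.TOP have "OUT2_plus G (Top, Y)" by (rule OUT2_plus.WO)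
  thus ?case by (rule OUT2_plus.SI) (simp add: entails_def)
next
  case (E2 G B A Y X)
  have "OUT2_plus (add_mset (A, X) G) (A, X)"
    by (simp add: OUT2_plus.Leaf)
  thus ?case
    by (rule OUT2_plus_E2) (auto intro: OUT2_plus_mono E2.IH)
qed

theorem theorem1:
  fixes G :: "'a io_pair multiset" and B Y :: "'a formula"
  shows "C2 G (B, Y) \<longleftrightarrow> OUT2_plus G (B, Y)"
  using C2_imp_OUT2_plus OUT2_plus_imp_separates separates_imp_C2 by blast

end
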